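(* Let $f$ be analytic in a set $A \supseteq (-1,1]$ with $f(0)=0$, and let $(a_n)_{n\ge 1}$ be an arbitrary sequence with $|a_n|<1$ for $n=1,2,3,\dots$. Then for every $x\ge 1$, $$\sum_{k\le x} f(a_k) \;=\; -\sum_{n=1}^{\infty} \frac{\log\Big(\prod_{k\le x}(1-a_k^n)\Big)}{n}\sum_{d\mid n}\frac{f^{(d)}(0)}{\Gamma(d)}\,\mu\!\left(\frac{n}{d}\right).$$
   Context: $\mu$ denotes the Möbius function: $\mu(1)=1$, $\mu(k)=(-1)^r$ if $k$ is a product of $r$ distinct primes, and $\mu(k)=0$ otherwise. $f^{(d)}(0)$ is the $d$-th derivative of $f$ at $0$ and $\Gamma$ is the Gamma function, so $\Gamma(d)=(d-1)!$. The sums over $k\le x$ run over positive integers $k\le x$.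
   Formalization: The a_n are real, and it is additionally assumed that the Maclaurin series of f converges on (-1,1); without this the identity fails, e.g. for f(z)=z/(1+4z^2), a_1=3/4, x=1, where the right-hand series diverges. *)

theory Defs
  imports
    "HOL-Complex_Analysis.Complex_Analysis"
    "HOL-Computational_Algebra.Squarefree"
begin

definition moebius_mu :: "nat \<Rightarrow> int" where
  "moebius_mu k = (if squarefree k then (- 1) ^ card (prime_factors k) else 0)"

end

theory Submission
  imports Defs "HOL-Real_Asymp.Real_Asymp"
begin

text \<open>
  Let \<open>f(z) = \<Sum> c\<^sub>d z\<^sup>d\<close> be the Maclaurin series; it converges on the unit disc and, by the
  identity theorem, represents \<open>f\<close> on the whole interval \<open>(-1,1)\<close>. The inner sum of the theorem is
  \<open>b\<^sub>n = \<Sum> d c\<^sub>d \<mu>(n/d)\<close> over \<open>d dvd n\<close>, so Moebius inversion gives \<open>\<Sum> b\<^sub>n = N c\<^sub>N\<close> over \<open>n dvd N\<close>.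
  Expanding \<open>- ln (1 - t\<^sup>n) / n\<close> as the sum of \<open>t\<^sup>N / N\<close> over the multiples \<open>N\<close> of \<open>n\<close> turns the right
  side into a double series of terms \<open>b\<^sub>n t\<^sup>N / N\<close> over pairs \<open>n dvd N\<close>. It converges absolutely, and
  summing over \<open>n\<close> first yields \<open>\<Sum> c\<^sub>N t\<^sup>N = f(t)\<close>.
\<close>

section \<open>The Moebius function and Moebius inversion\<close>

lemma moebius_mu_1 [simp]: "moebius_mu (Suc 0) = 1"
  by (simp add: moebius_mu_def)

lemma abs_moebius_mu_le_1: "\<bar>moebius_mu n\<bar> \<le> 1"
  by (simp add: moebius_mu_def power_abs)

lemma moebius_mu_prime_mult:
  assumes "prime p" "\<not> p dvd d"
  shows "moebius_mu (p * d) = - moebius_mu d"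
proof -
  have cop: "coprime p d"
    using assms by (simp add: prime_imp_coprime)
  have d0: "d \<noteq> 0" and p0: "p \<noteq> 0"
    using assms by (auto intro: Nat.gr0I)
  have sf: "squarefree (p * d) \<longleftrightarrow> squarefree d"
    using squarefree_mult_coprime[OF cop] squarefree_prime[OF assms(1)]
      squarefree_multD(2)[of p d] by auto
  have "prime_factors (p * d) = insert p (prime_factors d)"
    using d0 p0 assms(1) by (simp add: prime_factors_product prime_prime_factors)
  moreover have "p \<notin> prime_factors d"
    using assms(2) by auto
  ultimately show ?thesis
    by (simp add: moebius_mu_def sf)
qed

lemma moebius_mu_prime_square_dvd:
  assumes "prime p" "p\<^sup>2 dvd n"
  shows "moebius_mu n = 0"
  using assms by (metis not_squarefreeI not_prime_unit moebius_mu_def)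

text \<open>For \<open>n > 1\<close> fix a prime \<open>p\<close> dividing \<open>n\<close>.
  Divisors divisible by the square of \<open>p\<close> contribute zero, and the others cancel in
  pairs \<open>d\<close>, \<open>p * d\<close> with \<open>d\<close> prime to
  \<open>p\<close>.\<close>

lemma sum_moebius_mu_divisors:
  assumes "n > 0"
  shows "(\<Sum>d | d dvd n. moebius_mu d) = (if n = 1 then 1 else 0)"
proof (cases "n = 1")
  case False
  then obtain p where p: "prime p" "p dvd n"
    using prime_factor_nat by blast
  have fin: "finite {d. d dvd n}"
    using assms by simp
  define S where "S = {d. d dvd n \<and> \<not> p dvd d \<and> p * d dvd n}"
  define T where "T = {d. d dvd n \<and> p dvd d \<and> \<not> p\<^sup>2 dvd d}"
  \<comment> \<open>Coprime divisors of \<open>n\<close> have a product dividing \<open>n\<close>,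
    so every divisor prime to \<open>p\<close> has its partner in \<open>T\<close>.\<close>
  have S_eq: "S = {d. d dvd n \<and> \<not> p dvd d}"
    using p by (auto simp: S_def intro!: divides_mult prime_imp_coprime)
  have "(\<Sum>d\<in>T. moebius_mu d) = (\<Sum>d\<in>S. moebius_mu (p * d))"
    by (rule sum.reindex_bij_witness[of _ "\<lambda>d. p * d" "\<lambda>d. d div p"])
      (use p prime_gt_0_nat[OF p(1)] in
        \<open>auto simp: S_def T_def power2_eq_square elim!: dvdE\<close>)
  also have "\<dots> = (\<Sum>d\<in>S. - moebius_mu d)"
    by (rule sum.cong) (use p in \<open>auto simp: S_def moebius_mu_prime_mult\<close>)
  finally have T: "(\<Sum>d\<in>T. moebius_mu d) = - (\<Sum>d\<in>S. moebius_mu d)"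
    by (simp add: sum_negf)
  have "(\<Sum>d | d dvd n. moebius_mu d) = (\<Sum>d\<in>S \<union> T. moebius_mu d)"
    by (rule sum.mono_neutral_right)
      (use fin moebius_mu_prime_square_dvd[OF p(1)] in \<open>auto simp: S_eq T_def\<close>)
  also have "\<dots> = (\<Sum>d\<in>S. moebius_mu d) + (\<Sum>d\<in>T. moebius_mu d)"
    by (rule sum.union_disjoint) (use fin in \<open>auto simp: S_def T_def\<close>)
  finally show ?thesis
    using T False by simp
qed simp

text \<open>Writing \<open>m = d * e\<close> and summing over \<open>e\<close> first turns the inner
  sum into the divisor sum of the Moebius function at \<open>n div d\<close>, which vanishes unless
  \<open>d = n\<close>.\<close>

lemma moebius_inversion:
  fixes g :: "nat \<Rightarrow> 'a :: comm_ring_1"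
  assumes "n > 0"
  shows "(\<Sum>m | m dvd n. \<Sum>d | d dvd m. g d * of_int (moebius_mu (m div d))) = g n"
proof -
  have fin: "finite {d. d dvd m}" if "m dvd n" for m
    using that assms by (auto intro!: finite_divisors_nat Nat.gr0I)
  have "(\<Sum>m | m dvd n. \<Sum>d | d dvd m. g d * of_int (moebius_mu (m div d))) =
      (\<Sum>(m, d)\<in>Sigma {m. m dvd n} (\<lambda>m. {d. d dvd m}). g d * of_int (moebius_mu (m div d)))"
    by (rule sum.Sigma) (use fin in auto)
  also have "\<dots> = (\<Sum>(d, e)\<in>Sigma {d. d dvd n} (\<lambda>d. {e. e dvd n div d}).
      g d * of_int (moebius_mu e))"
    by (rule sum.reindex_bij_witness[of _ "\<lambda>(d, e). (d * e, d)" "\<lambda>(m, d). (d, m div d)"])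
      (use assms in \<open>auto elim!: dvdE\<close>)
  also have "\<dots> = (\<Sum>d | d dvd n. \<Sum>e | e dvd n div d. g d * of_int (moebius_mu e))"
    by (rule sum.Sigma[symmetric]) (use fin in \<open>auto simp: div_dvd_iff_mult elim!: dvdE\<close>)
  also have "\<dots> = (\<Sum>d | d dvd n. if d = n then g n else 0)"
  proof (rule sum.cong)
    fix d assume "d \<in> {d. d dvd n}"
    then obtain k where k: "n = d * k" by auto
    with assms have pos: "d > 0" "k > 0" by auto
    have "(\<Sum>e | e dvd n div d. g d * of_int (moebius_mu e)) =
        g d * of_int (\<Sum>e | e dvd k. moebius_mu e)"
      using k pos by (simp add: sum_distrib_left)
    also have "\<dots> = (if d = n then g n else 0)"
      using sum_moebius_mu_divisors[of k] k pos by auto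
    finally show "(\<Sum>e | e dvd n div d. g d * of_int (moebius_mu e)) = (if d = n then g n else 0)" .
  qed simp
  also have "\<dots> = g n"
    using fin[of n] by (simp add: sum.delta)
  finally show ?thesis .
qed

section \<open>Logarithm series over multiples and growth bounds\<close>

lemma has_sum_atLeast_1_iff:
  fixes h :: "nat \<Rightarrow> 'a :: {comm_monoid_add, topological_space}"
  assumes "h 0 = 0"
  shows "(h has_sum s) {1..} \<longleftrightarrow> (h has_sum s) UNIV"
  by (rule has_sum_cong_neutral) (use assms in \<open>auto simp: not_le\<close>)

text \<open>This is the series of \<open>- ln (1 - u)\<close> at \<open>u = t ^ n\<close>, divided
  by \<open>n\<close> and reindexed by \<open>N = n * j\<close>.\<close>

lemma has_sum_ln_one_minus_power:
  fixes t :: real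
  assumes t: "\<bar>t\<bar> < 1" and n: "n \<ge> 1"
  shows "((\<lambda>N. t ^ N / real N) has_sum (- ln (1 - t ^ n) / real n)) {N. N \<ge> 1 \<and> n dvd N}"
proof -
  have q: "\<bar>t ^ n\<bar> < 1"
    using t n by (simp add: power_abs power_less_one_iff)
  have sums: "(\<lambda>j. u ^ j / real j) sums (- ln (1 - u))" if "\<bar>u\<bar> < 1" for u :: real
    using sums_minus[OF ln_series'[of "-u"]] that by simp
  have "summable (\<lambda>j. norm ((t ^ n) ^ j / real j))"
    using sums_summable[OF sums[of "\<bar>t ^ n\<bar>"]] q by (simp add: power_abs)
  then have "((\<lambda>j. (t ^ n) ^ j / real j) has_sum (- ln (1 - t ^ n))) UNIV"
    using sums[OF q] by (rule norm_summable_imp_has_sum)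
  \<comment> \<open>The term at \<open>j = 0\<close> is zero because division by zero yields
    zero.\<close>
  then have "((\<lambda>j. (t ^ n) ^ j / real j) has_sum (- ln (1 - t ^ n))) {1..}"
    by (subst has_sum_atLeast_1_iff) auto
  then have "((\<lambda>j. 1 / real n * ((t ^ n) ^ j / real j)) has_sum
      (1 / real n * (- ln (1 - t ^ n)))) {1..}"
    by (rule has_sum_cmult_right)
  then have "((\<lambda>j. t ^ (n * j) / real (n * j)) has_sum (- ln (1 - t ^ n) / real n)) {1..}"
    by (simp add: power_mult)
  moreover have "bij_betw (\<lambda>j. n * j) {1..} {N. N \<ge> 1 \<and> n dvd N}"
    by (rule bij_betwI[of _ _ _ "\<lambda>N. N div n"]) (use n in \<open>auto elim!: dvdE\<close>)
  ultimately show ?thesis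
    using has_sum_reindex_bij_betw[where f = "\<lambda>N. t ^ N / real N"] by blast
qed

text \<open>There are at most \<open>n\<close> divisors, and each summand is at most
  \<open>n * M / r ^ n\<close>, because \<open>r \<le> 1\<close> gives
  \<open>M / r ^ d \<le> M / r ^ n\<close> for \<open>d \<le> n\<close>.\<close>

lemma norm_dirichlet_moebius_le:
  fixes c :: "nat \<Rightarrow> complex"
  assumes r: "0 < r" "r \<le> 1" and M: "\<And>n. norm (c n * of_real r ^ n) \<le> M" and n: "n \<ge> 1"
  shows "norm (\<Sum>d | d dvd n. of_nat d * c d * of_int (moebius_mu (n div d))) \<le> M * real n ^ 2 / r ^ n"
proof -
  have M0: "M \<ge> 0"
    using M[of 0] norm_ge_zero order_trans by blast
  have "norm (\<Sum>d | d dvd n. of_nat d * c d * of_int (moebius_mu (n div d)))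
      \<le> (\<Sum>d | d dvd n. real n * (M / r ^ n))"
  proof (rule sum_norm_le)
    fix d assume "d \<in> {d. d dvd n}"
    then have d: "d \<le> n"
      using n by (auto dest: dvd_imp_le)
    have "norm (c d) \<le> M / r ^ d"
      using M[of d] r by (simp add: norm_mult norm_power field_simps)
    also have "\<dots> \<le> M / r ^ n"
      using r d M0 by (intro divide_left_mono power_decreasing) auto
    finally have "norm (c d) \<le> M / r ^ n" .
    moreover have "\<bar>real_of_int (moebius_mu (n div d))\<bar> \<le> 1"
      using abs_moebius_mu_le_1[of "n div d"] by linarith
    ultimately have "(real d * norm (c d)) * \<bar>real_of_int (moebius_mu (n div d))\<bar>
        \<le> (real n * (M / r ^ n)) * 1"
      using d r M0 by (intro mult_mono) auto
    then show "norm (of_nat d * c d * of_int (moebius_mu (n div d))) \<le> real n * (M / r ^ n)"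
      by (simp add: norm_mult)
  qed
  also have "\<dots> = real (card {d. d dvd n}) * (real n * (M / r ^ n))"
    by simp
  also have "\<dots> \<le> real n * (real n * (M / r ^ n))"
  proof (rule mult_right_mono)
    have "card {d. d dvd n} \<le> card {1..n}"
      using n by (intro card_mono) (auto dest: dvd_imp_le intro!: Suc_leI Nat.gr0I)
    then show "real (card {d. d dvd n}) \<le> real n" by simp
  qed (use r M0 in auto)
  finally show ?thesis
    by (simp add: power2_eq_square mult_ac)
qed

lemma summable_square_times_power:
  fixes q :: real
  assumes "0 \<le> q" "q < 1"
  shows "summable (\<lambda>n. real n ^ 2 * q ^ n)"
\<comment> \<open>The value \<open>q = 0\<close>, which arises from \<open>t = 0\<close>, is split
  off: the asymptotic comparison with the inverse squares is made for \<open>0 < q\<close>.\<close>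
proof (cases "q = 0")
  case True
  then show ?thesis by (intro summable_finite[of "{0}"]) auto
next
  case False
  with assms have "0 < q" by simp
  then have "(\<lambda>n. real n ^ 2 * q ^ n) \<in> O(\<lambda>n. 1 / real n ^ 2)"
    using assms(2) by real_asymp
  moreover have "summable (\<lambda>n. norm (1 / real n ^ 2))"
    using inverse_power_summable[of 2, where 'a = real] by (simp add: field_simps)
  ultimately show ?thesis
    by (rule summable_comparison_test_bigo[rotated])
qed

section \<open>The double series for one argument\<close>

lemma sums_ln_one_minus_power_moebius:
  fixes c :: "nat \<Rightarrow> complex" and t :: real
  assumes conv: "\<And>u :: real. \<bar>u\<bar> < 1 \<Longrightarrow> summable (\<lambda>n. c n * of_real u ^ n)"
    and c0: "c 0 = 0" and t: "\<bar>t\<bar> < 1"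
  defines "b \<equiv> \<lambda>n. \<Sum>d | d dvd n. of_nat d * c d * of_int (moebius_mu (n div d))"
  shows "(\<lambda>m. of_real (ln (1 - t ^ Suc m)) / of_nat (Suc m) * b (Suc m)) sums
    (- (\<Sum>n. c n * of_real t ^ n))"
proof -
  \<comment> \<open>The multiple \<open>N\<close> comes first, so the fibre \<open>D N\<close> over
    each \<open>N \<ge> 1\<close> is a finite set of divisors and absolute convergence reduces to a
    single series in \<open>N\<close>.\<close>
  define F :: "nat \<times> nat \<Rightarrow> complex" where
    "F = (\<lambda>(N, n). b n * of_real (t ^ N / real N))"
  define D where "D = (\<lambda>N::nat. {n. n dvd N})"
  \<comment> \<open>Convergence at \<open>r\<close> bounds the terms \<open>c n * r ^ n\<close>; the
    gap between \<open>\<bar>t\<bar>\<close> and \<open>r\<close> leaves a geometric factor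
    \<open>\<bar>t\<bar> / r\<close> below 1.\<close>
  obtain r where r: "\<bar>t\<bar> < r" "r < 1"
    using t dense by blast
  then have r0: "0 < r" by linarith
  obtain M where M: "\<And>n. norm (c n * of_real r ^ n) \<le> M"
    using summable_imp_Bseq[OF conv[of r]] r r0 by (auto simp: Bseq_def)
  have M0: "M \<ge> 0"
    using M[of 0] norm_ge_zero order_trans by blast
  have finD: "finite (D N)" if "N \<in> {1..}" for N
    using that by (auto simp: D_def)

  have bound: "norm (F (N, n)) \<le> M * real N * (\<bar>t\<bar> / r) ^ N" if "N \<ge> 1" "n dvd N" for N n
  proof -
    have n: "1 \<le> n" "n \<le> N"
      using that by (auto dest: dvd_imp_le intro!: Suc_leI Nat.gr0I)
    have "norm (b n) \<le> M * real n ^ 2 / r ^ n"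
      unfolding b_def by (rule norm_dirichlet_moebius_le) (use r0 r M n in auto)
    \<comment> \<open>Since \<open>n \<le> N\<close> and \<open>r < 1\<close>, the bound for
      \<open>b n\<close> is replaced by one that is uniform over the fibre.\<close>
    also have "\<dots> \<le> M * real N ^ 2 / r ^ N"
      using n r0 r M0 by (intro frac_le mult_left_mono power_mono power_decreasing) auto
    finally have "norm (b n) * (\<bar>t\<bar> ^ N / real N) \<le> M * real N ^ 2 / r ^ N * (\<bar>t\<bar> ^ N / real N)"
      by (rule mult_right_mono) auto
    also have "\<dots> = M * real N * (\<bar>t\<bar> / r) ^ N"
      using that r0 by (simp add: field_simps power2_eq_square)
    finally show ?thesis
      by (simp add: F_def norm_mult norm_divide norm_power)
  qed
  have q: "summable (\<lambda>N. M * (real N ^ 2 * (\<bar>t\<bar> / r) ^ N))"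
    by (intro summable_mult summable_square_times_power) (use r r0 in auto)
  have "(\<lambda>p. norm (F p)) summable_on Sigma {1..} D"
    unfolding Infinite_Sum.abs_summable_on_Sigma_iff
  proof (intro conjI ballI)
    have "(\<lambda>N. M * (real N ^ 2 * (\<bar>t\<bar> / r) ^ N)) summable_on UNIV"
      by (rule norm_summable_imp_summable_on) (use q M0 r0 in simp)
    then have "(\<lambda>N. M * (real N ^ 2 * (\<bar>t\<bar> / r) ^ N)) summable_on {1..}"
      by (rule summable_on_subset) auto
    then show "(\<lambda>N. norm (\<Sum>\<^sub>\<infinity>n\<in>D N. norm (F (N, n)))) summable_on {1..}"
    proof (rule summable_on_comparison_test)
      fix N :: nat assume N: "N \<in> {1..}"
      have "(\<Sum>\<^sub>\<infinity>n\<in>D N. norm (F (N, n))) = (\<Sum>n\<in>D N. norm (F (N, n)))"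
        by (rule infsum_finite[OF finD[OF N]])
      also have "\<dots> \<le> real (card (D N)) * (M * real N * (\<bar>t\<bar> / r) ^ N)"
        by (rule sum_bounded_above) (use N bound in \<open>auto simp: D_def\<close>)
      \<comment> \<open>Counting at most \<open>N\<close> divisors supplies the second factor
        \<open>N\<close> in the majorant.\<close>
      also have "\<dots> \<le> real N * (M * real N * (\<bar>t\<bar> / r) ^ N)"
      proof (rule mult_right_mono)
        have "card (D N) \<le> card {1..N}"
          using N by (intro card_mono) (auto simp: D_def dest: dvd_imp_le intro!: Suc_leI Nat.gr0I)
        then show "real (card (D N)) \<le> real N" by simp
      qed (use M0 r0 in auto)
      finally show "norm (\<Sum>\<^sub>\<infinity>n\<in>D N. norm (F (N, n))) \<le> M * (real N ^ 2 * (\<bar>t\<bar> / r) ^ N)"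
        by (simp add: infsum_nonneg power2_eq_square mult_ac)
    qed auto
  qed (use finD in auto)
  then have F_summable: "F summable_on Sigma {1..} D"
    by (rule abs_summable_summable)

  have "summable (\<lambda>n. norm (c n * of_real t ^ n))"
    using powser_insidea[OF conv[of r], of "of_real t"] r r0 by simp
  then have "((\<lambda>n. c n * of_real t ^ n) has_sum (\<Sum>n. c n * of_real t ^ n)) UNIV"
    using summable_sums[OF conv[OF t]] by (rule norm_summable_imp_has_sum)
  then have c_sum: "((\<lambda>n. c n * of_real t ^ n) has_sum (\<Sum>n. c n * of_real t ^ n)) {1..}"
    by (subst has_sum_atLeast_1_iff) (use c0 in auto)
  \<comment> \<open>On the fibre over \<open>N\<close>, Moebius inversion gives
    \<open>N * c N\<close>, and the factor \<open>N\<close> cancels the denominator.\<close>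
  have "((\<lambda>n. F (N, n)) has_sum (c N * of_real t ^ N)) (D N)" if "N \<in> {1..}" for N
  proof (rule has_sum_finiteI[OF finD[OF that]])
    have "(\<Sum>n\<in>D N. F (N, n)) = (\<Sum>n\<in>D N. b n) * of_real (t ^ N / real N)"
      by (simp add: F_def sum_distrib_right sum_divide_distrib)
    also have "(\<Sum>n\<in>D N. b n) = of_nat N * c N"
      unfolding D_def b_def using that moebius_inversion[of N "\<lambda>d. of_nat d * c d"] by simp
    finally show "c N * of_real t ^ N = (\<Sum>n\<in>D N. F (N, n))"
      using that by simp
  qed
  then have "(F has_sum (\<Sum>n. c n * of_real t ^ n)) (Sigma {1..} D)"
    using c_sum F_summable by (rule has_sum_SigmaI)
  \<comment> \<open>The same pairs are now fibred over \<open>n\<close>; the fibre consists of the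
    positive multiples of \<open>n\<close>, where the logarithm series applies.\<close>
  moreover have "bij_betw prod.swap (Sigma {1..} (\<lambda>n. {N. N \<ge> 1 \<and> n dvd N})) (Sigma {1..} D)"
    by (rule bij_betwI[of _ _ _ prod.swap]) (auto simp: D_def intro!: Suc_leI Nat.gr0I)
  ultimately have "((\<lambda>p. F (prod.swap p)) has_sum (\<Sum>n. c n * of_real t ^ n))
      (Sigma {1..} (\<lambda>n. {N. N \<ge> 1 \<and> n dvd N}))"
    using has_sum_reindex_bij_betw by blast
  then have "((\<lambda>n. b n * of_real (- ln (1 - t ^ n) / real n)) has_sum (\<Sum>n. c n * of_real t ^ n)) {1..}"
  proof (rule has_sum_SigmaD)
    fix n :: nat assume "n \<in> {1..}"
    then have "((\<lambda>N. b n * of_real (t ^ N / real N)) has_sum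
        (b n * of_real (- ln (1 - t ^ n) / real n))) {N. N \<ge> 1 \<and> n dvd N}"
      by (intro has_sum_cmult_right has_sum_of_real has_sum_ln_one_minus_power t) auto
    then show "((\<lambda>N. F (prod.swap (n, N))) has_sum
        (b n * of_real (- ln (1 - t ^ n) / real n))) {N. N \<ge> 1 \<and> n dvd N}"
      by (simp add: F_def)
  qed
  moreover have "bij_betw Suc UNIV {1..}"
    by (rule bij_betwI[of _ _ _ "\<lambda>n. n - 1"]) auto
  ultimately have "((\<lambda>m. b (Suc m) * of_real (- ln (1 - t ^ Suc m) / real (Suc m)))
      has_sum (\<Sum>n. c n * of_real t ^ n)) UNIV"
    using has_sum_reindex_bij_betw[of Suc UNIV "{1..}"
        "\<lambda>n. b n * of_real (- ln (1 - t ^ n) / real n)"] by blast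
  from sums_minus[OF has_sum_imp_sums[OF this]] show ?thesis
    by (simp add: mult_ac)
qed

section \<open>Identity theorem on the interval\<close>

text \<open>Near 0 the series represents \<open>f\<close>; the identity theorem carries this along
  the interval, inside a connected open set where both \<open>f\<close> and the series are
  holomorphic.\<close>

lemma analytic_on_interval_eq_maclaurin:
  fixes f :: "complex \<Rightarrow> complex" and t :: real
  assumes f: "f analytic_on (complex_of_real ` {-1<..<1})"
    and conv: "\<And>u :: real. \<bar>u\<bar> < 1 \<Longrightarrow>
      summable (\<lambda>d. (deriv ^^ d) f 0 / fact d * complex_of_real u ^ d)"
    and t: "\<bar>t\<bar> < 1"
  shows "f (of_real t) = (\<Sum>d. (deriv ^^ d) f 0 / fact d * complex_of_real t ^ d)"
proof -
  define I where "I = complex_of_real ` {-1<..<1}"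
  define F where "F = fps_expansion f 0"
  obtain S where S: "open S" "I \<subseteq> S" "f holomorphic_on S"
    using f unfolding analytic_on_holomorphic I_def by blast
  \<comment> \<open>The intersection may be disconnected, so only the component of 0 is kept; it
    contains the connected set \<open>I\<close>.\<close>
  define C where "C = connected_component_set (S \<inter> ball 0 1) 0"
  have I0: "0 \<in> I" and It: "of_real t \<in> I"
    using t by (auto simp: I_def image_iff intro: bexI[of _ 0])
  have "connected I"
    unfolding I_def by (intro connected_continuous_image continuous_intros) auto
  moreover have "I \<subseteq> S \<inter> ball 0 1"
    using S by (auto simp: I_def)
  ultimately have IC: "I \<subseteq> C"
    unfolding C_def using I0 by (intro connected_component_maximal)
  have C: "open C" "connected C" "C \<subseteq> S \<inter> ball 0 1"
    using S connected_component_subset[of "S \<inter> ball 0 1" 0]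
    by (auto simp: C_def intro!: open_connected_component)
  have expansion: "f has_fps_expansion F"
    unfolding F_def by (rule has_fps_expansion_fps_expansion[of S]) (use S I0 in auto)
  have "fps_conv_radius F \<ge> 1"
    unfolding fps_conv_radius_def
    by (rule conv_radius_geI_ex') (use conv in \<open>auto simp: F_def fps_expansion_def\<close>)
  then have "eball 0 1 \<subseteq> eball (0 :: complex) (fps_conv_radius F)"
    by (rule eball_mono)
  then have "C \<subseteq> eball 0 (fps_conv_radius F)"
    using C(3) eball_ereal[of "0 :: complex" 1] by (simp add: one_ereal_def le_inf_iff) blast
  then have "eval_fps F holomorphic_on C"
    by (rule holomorphic_on_eval_fps)
  moreover have "f holomorphic_on C"
    using S(3) by (rule holomorphic_on_subset) (use C in auto)
  moreover have "(deriv ^^ n) f 0 = (deriv ^^ n) (eval_fps F) 0" for n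
    using expansion by (intro higher_deriv_cong_ev) (auto simp: has_fps_expansion_def eq_commute)
  ultimately have "f (of_real t) = eval_fps F (of_real t)"
    using C(1,2) I0 It IC by (intro holomorphic_fun_eq_on_connected[of f C _ 0]) auto
  then show ?thesis
    by (simp add: eval_fps_def F_def fps_expansion_def)
qed

section \<open>Summation over the terms of the sequence\<close>

text \<open>Analyticity near the real interval does not force the Maclaurin series to converge on
  all of it: \<open>z / (1 + 4 * z^2)\<close> has poles at distance 1/2 from 0. Hence
  \<open>maclaurin_convergent\<close> is an explicit hypothesis.\<close>

theorem theorem1:
  fixes f :: "complex \<Rightarrow> complex" and A :: "complex set"
    and a :: "nat \<Rightarrow> real" and x :: real
  assumes "f analytic_on A"
    and "complex_of_real ` {-1<..1} \<subseteq> A"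
    and "f 0 = 0"
    and maclaurin_convergent:
      "\<And>t :: real. \<bar>t\<bar> < 1 \<Longrightarrow>
         summable (\<lambda>d. (deriv ^^ d) f 0 / fact d * complex_of_real t ^ d)"
    and "\<And>n. n \<ge> 1 \<Longrightarrow> \<bar>a n\<bar> < 1"
    and "x \<ge> 1"
  shows "(\<lambda>m. let n = Suc m in
      complex_of_real (ln (\<Prod>k | 1 \<le> k \<and> real k \<le> x. 1 - a k ^ n)) / of_nat n *
      (\<Sum>d | d dvd n. (deriv ^^ d) f 0 / Gamma (of_nat d) * of_int (moebius_mu (n div d))))
    sums (- (\<Sum>k | 1 \<le> k \<and> real k \<le> x. f (complex_of_real (a k))))"
proof -
  define K where "K = {k. 1 \<le> k \<and> real k \<le> x}"
  define c where "c = (\<lambda>d. (deriv ^^ d) f 0 / fact d)"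
  define b where "b = (\<lambda>n. \<Sum>d | d dvd n. of_nat d * c d * of_int (moebius_mu (n div d)))"
  have "K \<subseteq> {..nat \<lfloor>x\<rfloor>}"
    by (auto simp: K_def le_nat_floor)
  then have finK: "finite K"
    using finite_subset by blast
  have f_I: "f analytic_on (complex_of_real ` {-1<..<1})"
    using assms(1) by (rule analytic_on_subset) (use assms(2) in force)
  have "(\<lambda>m. \<Sum>k\<in>K. of_real (ln (1 - a k ^ Suc m)) / of_nat (Suc m) * b (Suc m)) sums
      (\<Sum>k\<in>K. - f (of_real (a k)))"
  proof (rule sums_sum)
    fix k assume "k \<in> K"
    then have ak: "\<bar>a k\<bar> < 1"
      using assms(5) by (simp add: K_def)
    have "f (of_real (a k)) = (\<Sum>d. c d * of_real (a k) ^ d)"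
      unfolding c_def by (rule analytic_on_interval_eq_maclaurin[OF f_I maclaurin_convergent ak])
    then show "(\<lambda>m. of_real (ln (1 - a k ^ Suc m)) / of_nat (Suc m) * b (Suc m)) sums
        (- f (of_real (a k)))"
      using sums_ln_one_minus_power_moebius[of c "a k"] maclaurin_convergent assms(3) ak
      by (simp add: c_def b_def)
  qed
  moreover have "(let n = Suc m in
      complex_of_real (ln (\<Prod>k\<in>K. 1 - a k ^ n)) / of_nat n *
      (\<Sum>d | d dvd n. (deriv ^^ d) f 0 / Gamma (of_nat d) * of_int (moebius_mu (n div d)))) =
    (\<Sum>k\<in>K. of_real (ln (1 - a k ^ Suc m)) / of_nat (Suc m) * b (Suc m))" for m
  proof -
    \<comment> \<open>Nonzero factors allow the logarithm of the product to split into a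
      sum.\<close>
    have "1 - a k ^ Suc m \<noteq> 0" if "k \<in> K" for k
    proof -
      have "\<bar>a k\<bar> < 1"
        using that assms(5) by (simp add: K_def)
      then have "\<bar>a k ^ Suc m\<bar> < 1"
        unfolding power_abs by (subst power_less_one_iff) auto
      then show ?thesis by linarith
    qed
    then have "ln (\<Prod>k\<in>K. 1 - a k ^ Suc m) = (\<Sum>k\<in>K. ln (1 - a k ^ Suc m))"
      using finK by (intro ln_prod) auto
    moreover have "(\<Sum>d | d dvd Suc m. (deriv ^^ d) f 0 / Gamma (of_nat d) *
        of_int (moebius_mu (Suc m div d))) = b (Suc m)"
      unfolding b_def
    proof (rule sum.cong)
      fix d assume "d \<in> {d. d dvd Suc m}"
      then obtain e where d: "d = Suc e"
        by (cases d) auto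
      \<comment> \<open>A divisor \<open>d\<close> of \<open>Suc m\<close> is positive, so
        \<open>Gamma d\<close> is the factorial of \<open>d - 1\<close>; dividing by it instead of
        by \<open>fact d\<close> multiplies the coefficient \<open>c d\<close> by
        \<open>d\<close>.\<close>
      have "Gamma (of_nat d :: complex) = fact e"
        using Gamma_fact[of e, where 'a = complex] by (simp add: d)
      moreover have "(fact d :: complex) = of_nat d * fact e"
        by (simp add: d)
      ultimately have "(deriv ^^ d) f 0 / Gamma (of_nat d) = of_nat d * c d"
        by (simp add: c_def d del: of_nat_Suc fact_Suc funpow.simps)
      then show "(deriv ^^ d) f 0 / Gamma (of_nat d) * of_int (moebius_mu (Suc m div d)) =
          of_nat d * c d * of_int (moebius_mu (Suc m div d))"
        by simp
    qed simp
    ultimately show ?thesis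
      by (simp add: Let_def sum_distrib_right sum_divide_distrib)
  qed
  ultimately show ?thesis
    unfolding K_def[symmetric] by (simp add: sum_negf)
qed

end
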